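(* Let $\mathbb{T}$ be a time scale with $0\in\mathbb{T}$ and let $\omega:\mathbb{T}\to\mathbb{C}$ be rd-continuous with $i\omega$ regressive. If $\omega$ is real-valued, then the Cayley-trigonometric functions $\mathrm{Cos}_\omega$, $\mathrm{Sin}_\omega$ are real-valued. Moreover, $$\mathrm{Cos}_\omega^2(t)+\mathrm{Sin}_\omega^2(t)=1\qquad(t\in\mathbb{T})$$ and $$\mathrm{Cos}_\omega^\Delta(t)=-\omega(t)\,\langle\mathrm{Sin}_\omega(t)\rangle,\qquad \mathrm{Sin}_\omega^\Delta(t)=\omega(t)\,\langle\mathrm{Cos}_\omega(t)\rangle\qquad(t\in\mathbb{T}^\kappa),$$ where $\langle x(t)\rangle:=\frac{x(t)+x(\sigma(t))}{2}$.
   Context: A time scale $\mathbb{T}$ is a nonempty closed subset of $\mathbb{R}$. Forward jump: $\sigma(t)=\inf\{s\in\mathbb{T}:s>t\}$ (with $\inf\emptyset=\sup\mathbb{T}$). A point $t$ is right-dense if $\sigma(t)=t$, right-scattered if $\sigma(t)>t$; left-dense/left-scattered are defined analogously with the backward jump operator. $\mathbb{T}^\kappa$ is $\mathbb{T}$ minus its left-scattered maximum if that exists, and $\mathbb{T}^\kappa=\mathbb{T}$ otherwise. Graininess: $\mu(t)=\sigma(t)-t$. A function is rd-continuous if it is continuous at right-dense points and has finite left-hand limits at left-dense points. The delta derivative at $t\in\mathbb{T}^\kappa$ is $f^\Delta(t)=\lim_{s\to t,\,s\neq\sigma(t)}\frac{f(\sigma(t))-f(s)}{\sigma(t)-s}$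 ($s\in\mathbb{T}$, $s=t$ allowed when $t\ne\sigma(t)$). The delta integral is $\int_{t_0}^t f(s)\,\Delta s=F(t)-F(t_0)$ where $F^\Delta=f$ on $\mathbb{T}^\kappa$; it exists for rd-continuous $f$. A function $\alpha:\mathbb{T}\to\mathbb{C}$ is regressive if $\mu(t)\alpha(t)\neq\pm2$ for all $t\in\mathbb{T}^\kappa$. With $\log$ the principal branch of the complex logarithm, $\zeta_h(z)=\frac1h\log\frac{1+\frac12zh}{1-\frac12zh}$ for $h>0$ and $\zeta_0(z)=z$. For rd-continuous regressive $\alpha$, $E_\alpha(t)=\exp\left(\int_{0}^t\zeta_{\mu(s)}(\alpha(s))\,\Delta s\right)$. The Cayley-trigonometric functions are $\mathrm{Cos}_\omega(t)=\frac{E_{i\omega}(t)+E_{-i\omega}(t)}2$, $\mathrm{Sin}_\omega(t)=\frac{E_{i\omega}(t)-E_{-i\omega}(t)}{2i}$. *)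

theory Defs
  imports "HOL-Analysis.Analysis"
begin

text \<open>
  Functions on a time scale \<open>T\<close> are total functions on the reals; every notion below only
  inspects their values on \<open>T\<close>.
\<close>

definition time_scale :: "real set \<Rightarrow> bool" where
  "time_scale T \<longleftrightarrow> closed T \<and> T \<noteq> {}"

definition fwd_jump :: "real set \<Rightarrow> real \<Rightarrow> real" where
  "fwd_jump T t = (if {s \<in> T. s > t} = {} then Sup T else Inf {s \<in> T. s > t})"

definition bwd_jump :: "real set \<Rightarrow> real \<Rightarrow> real" where
  "bwd_jump T t = (if {s \<in> T. s < t} = {} then Inf T else Sup {s \<in> T. s < t})"

definition graininess :: "real set \<Rightarrow> real \<Rightarrow> real" where
  "graininess T t = fwd_jump T t - t"

text \<open>
  No extremality conditions are imposed here: a maximum of \<open>T\<close> counts as right-dense and a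
  minimum as left-dense.
\<close>

definition right_dense :: "real set \<Rightarrow> real \<Rightarrow> bool" where
  "right_dense T t \<longleftrightarrow> fwd_jump T t = t"

definition left_dense :: "real set \<Rightarrow> real \<Rightarrow> bool" where
  "left_dense T t \<longleftrightarrow> bwd_jump T t = t"

definition left_scattered :: "real set \<Rightarrow> real \<Rightarrow> bool" where
  "left_scattered T t \<longleftrightarrow> bwd_jump T t < t"

definition kappa :: "real set \<Rightarrow> real set" where
  "kappa T = T - {m \<in> T. (\<forall>s\<in>T. s \<le> m) \<and> left_scattered T m}"

definition rd_continuous :: "real set \<Rightarrow> (real \<Rightarrow> complex) \<Rightarrow> bool" where
  "rd_continuous T f \<longleftrightarrow>
     (\<forall>t\<in>T. right_dense T t \<longrightarrow> continuous (at t within T) f) \<and>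
     (\<forall>t\<in>T. left_dense T t \<longrightarrow> (\<exists>l. (f \<longlongrightarrow> l) (at t within (T \<inter> {..<t}))))"

text \<open>
  The filter describes \<open>s \<rightarrow> t\<close> with \<open>s \<in> T\<close>, \<open>s \<noteq> \<sigma>(t)\<close>. Unlike for \<open>at t within T\<close>, the value
  \<open>s = t\<close> is admitted when \<open>t\<close> is right-scattered. The filter is trivial for \<open>t \<in> kappa T\<close> only
  if \<open>T = {t}\<close>.
\<close>

definition has_delta_derivative ::
    "real set \<Rightarrow> (real \<Rightarrow> complex) \<Rightarrow> complex \<Rightarrow> real \<Rightarrow> bool" where
  "has_delta_derivative T f D t \<longleftrightarrow>
     ((\<lambda>s. (f (fwd_jump T t) - f s) / complex_of_real (fwd_jump T t - s)) \<longlongrightarrow> D)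
       (inf (nhds t) (principal (T - {fwd_jump T t})))"

definition delta_antiderivative ::
    "real set \<Rightarrow> (real \<Rightarrow> complex) \<Rightarrow> (real \<Rightarrow> complex) \<Rightarrow> bool" where
  "delta_antiderivative T f F \<longleftrightarrow> (\<forall>t\<in>kappa T. has_delta_derivative T F (f t) t)"

definition delta_integral ::
    "real set \<Rightarrow> real \<Rightarrow> real \<Rightarrow> (real \<Rightarrow> complex) \<Rightarrow> complex" where
  "delta_integral T a b f = (THE I. \<exists>F. delta_antiderivative T f F \<and> I = F b - F a)"

definition regressive :: "real set \<Rightarrow> (real \<Rightarrow> complex) \<Rightarrow> bool" where
  "regressive T \<alpha> \<longleftrightarrow>
     (\<forall>t\<in>kappa T. complex_of_real (graininess T t) * \<alpha> t \<noteq> 2 \<and>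
                  complex_of_real (graininess T t) * \<alpha> t \<noteq> - 2)"

definition cayley_zeta :: "real \<Rightarrow> complex \<Rightarrow> complex" where
  "cayley_zeta h z =
     (if h = 0 then z
      else 1 / complex_of_real h *
           Ln ((1 + 1 / 2 * z * complex_of_real h) / (1 - 1 / 2 * z * complex_of_real h)))"

definition cayley_exp :: "real set \<Rightarrow> (real \<Rightarrow> complex) \<Rightarrow> real \<Rightarrow> complex" where
  "cayley_exp T \<alpha> t = exp (delta_integral T 0 t (\<lambda>s. cayley_zeta (graininess T s) (\<alpha> s)))"

definition cayley_cos :: "real set \<Rightarrow> (real \<Rightarrow> complex) \<Rightarrow> real \<Rightarrow> complex" where
  "cayley_cos T \<omega> t =
     (cayley_exp T (\<lambda>s. \<i> * \<omega> s) t + cayley_exp T (\<lambda>s. - \<i> * \<omega> s) t) / 2"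

definition cayley_sin :: "real set \<Rightarrow> (real \<Rightarrow> complex) \<Rightarrow> real \<Rightarrow> complex" where
  "cayley_sin T \<omega> t =
     (cayley_exp T (\<lambda>s. \<i> * \<omega> s) t - cayley_exp T (\<lambda>s. - \<i> * \<omega> s) t) / (2 * \<i>)"

definition jump_avg :: "real set \<Rightarrow> (real \<Rightarrow> complex) \<Rightarrow> real \<Rightarrow> complex" where
  "jump_avg T x t = (x t + x (fwd_jump T t)) / 2"

end

theory Submission
  imports Defs
begin

text \<open>
  Writing \<open>\<langle>x\<rangle>\<close> for the jump average, the Cayley exponential solves \<open>E\<^sup>\<Delta> = \<alpha> \<langle>E\<rangle>\<close>: at
  right-scattered points this is the Cayley transform \<open>E(\<sigma>(t)) = (1 + z) / (1 - z) E(t)\<close> with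
  \<open>z = \<alpha>(t) \<mu>(t) / 2\<close>, at right-dense points it is the chain rule.
  By the symmetric Leibniz rule \<open>(X Y)\<^sup>\<Delta> = X\<^sup>\<Delta> \<langle>Y\<rangle> + \<langle>X\<rangle> Y\<^sup>\<Delta>\<close>, solutions for \<open>\<alpha>\<close> and \<open>-\<alpha>\<close> have a
  constant product. Applied to \<open>E(\<i>\<omega>)\<close> and \<open>E(-\<i>\<omega>)\<close> this gives \<open>Cos\<^sup>2 + Sin\<^sup>2 = 1\<close>; applied to
  \<open>E(\<i>\<omega>)\<close> and its conjugate for real \<open>\<omega>\<close> it gives \<open>E(-\<i>\<omega>) = cnj E(\<i>\<omega>)\<close>. Working with products
  instead of logarithms avoids the branch cut of \<open>Ln\<close>, where \<open>\<zeta>(-\<alpha>) = -\<zeta>(\<alpha>)\<close> fails.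

  That delta integrals exist follows by integrating \<open>f(floor_pt T x)\<close>, the extension of \<open>f\<close> that is
  constant on the gaps of \<open>T\<close>: it has one-sided limits everywhere and is thus integrable.
\<close>

section \<open>Integrability of functions with one-sided limits\<close>

text \<open>The one-sided limits put \<open>f\<close> within \<open>e\<close> of one constant on
  each side of any point \<open>x\<close>, close to \<open>x\<close>. Cousin's lemma (a fine tagged
  division) reduces this to finitely many intervals, and patching gives an integrable function
  uniformly \<open>e\<close>-close to \<open>f\<close>.\<close>

lemma regulated_imp_integrable:
  fixes f :: "real \<Rightarrow> 'a::banach"
  assumes L: "\<And>x. a < x \<Longrightarrow> x \<le> b \<Longrightarrow> \<exists>l. (f \<longlongrightarrow> l) (at_left x)"
    and R: "\<And>x. a \<le> x \<Longrightarrow> x < b \<Longrightarrow> \<exists>l. (f \<longlongrightarrow> l) (at_right x)"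
  shows "f integrable_on {a..b}"
proof -
  have "\<exists>g. (\<forall>x\<in>cbox a b. norm (f x - g x) \<le> e) \<and> g integrable_on cbox a b" if "e > 0" for e
  proof -
    have "\<exists>d>0. \<exists>l r. \<forall>y\<in>{a..b}. (x - d < y \<and> y < x \<longrightarrow> norm (f y - l) \<le> e) \<and>
        (x < y \<and> y < x + d \<longrightarrow> norm (f y - r) \<le> e)" if x: "x \<in> {a..b}" for x
    proof -
      have "\<exists>d>0. \<exists>l. \<forall>y\<in>{a..b}. x - d < y \<and> y < x \<longrightarrow> norm (f y - l) \<le> e"
      proof (cases "a < x")
        case True
        then obtain l where "(f \<longlongrightarrow> l) (at_left x)"
          using L x by auto
        from tendstoD[OF this \<open>e > 0\<close>] obtain z where "z < x" "\<forall>y>z. y < x \<longrightarrow> dist (f y) l < e"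
          by (auto simp: eventually_at_left_field)
        then show ?thesis
          by (intro exI[of _ "x - z"] conjI exI[of _ l]) (auto simp: dist_norm intro: less_imp_le)
      qed (use x in \<open>auto intro!: exI[of _ 1]\<close>)
      moreover have "\<exists>d>0. \<exists>r. \<forall>y\<in>{a..b}. x < y \<and> y < x + d \<longrightarrow> norm (f y - r) \<le> e"
      proof (cases "x < b")
        case True
        then obtain l where "(f \<longlongrightarrow> l) (at_right x)"
          using R x by auto
        from tendstoD[OF this \<open>e > 0\<close>] obtain z where "z > x" "\<forall>y>x. y < z \<longrightarrow> dist (f y) l < e"
          by (auto simp: eventually_at_right_field)
        then show ?thesis
          by (intro exI[of _ "z - x"] conjI exI[of _ l]) (auto simp: dist_norm intro: less_imp_le)
      qed (use x in \<open>auto intro!: exI[of _ 1]\<close>)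
      ultimately obtain d d' l r where "d > 0" "d' > 0"
        "\<forall>y\<in>{a..b}. x - d < y \<and> y < x \<longrightarrow> norm (f y - l) \<le> e"
        "\<forall>y\<in>{a..b}. x < y \<and> y < x + d' \<longrightarrow> norm (f y - r) \<le> e"
        by blast
      then show ?thesis
        by (intro exI[of _ "min d d'"] conjI exI[of _ l] exI[of _ r]) auto
    qed
    then obtain d l r where d: "\<And>x. x \<in> {a..b} \<Longrightarrow> d x > 0"
      and lr: "\<And>x y. x \<in> {a..b} \<Longrightarrow> y \<in> {a..b} \<Longrightarrow>
          (x - d x < y \<and> y < x \<longrightarrow> norm (f y - l x) \<le> e) \<and>
          (x < y \<and> y < x + d x \<longrightarrow> norm (f y - r x) \<le> e)"
      by metis
    have "gauge (\<lambda>x. ball x (if x \<in> {a..b} then d x else 1))"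
      by (rule gauge_ball_dependent) (use d in auto)
    then obtain p where p: "p tagged_division_of {a..b}"
      and fine: "(\<lambda>x. ball x (if x \<in> {a..b} then d x else 1)) fine p"
      using fine_division_exists_real by blast
    have "\<exists>g. (\<forall>x\<in>K. norm (f x - g x) \<le> e) \<and> g integrable_on K" if "K \<in> snd ` p" for K
    proof -
      obtain x where xK: "(x, K) \<in> p"
        using \<open>K \<in> snd ` p\<close> by auto
      have x: "x \<in> K" and sub: "K \<subseteq> {a..b}"
        using tagged_division_ofD(2,3)[OF p xK] by auto
      obtain u v where K: "K = {u..v}"
        using tagged_division_ofD(4)[OF p xK] by auto
      have xab: "x \<in> {a..b}"
        using x sub by blast
      have ball: "K \<subseteq> ball x (d x)"
        using fineD[OF fine xK] xab by simp
      \<comment> \<open>The one-sided limits do not control \<open>f\<close> at the tag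
        \<open>x\<close> itself, so \<open>g\<close> copies that value; a change at one point does
        not affect integrability.\<close>
      define g where "g = (\<lambda>y. if y < x then l x else if y = x then f x else r x)"
      have "g integrable_on {u..x}"
        by (rule integrable_spike_finite[of "{x}" _ _ "\<lambda>_. l x"]) (auto simp: g_def)
      moreover have "g integrable_on {x..v}"
        by (rule integrable_spike_finite[of "{x}" _ _ "\<lambda>_. r x"]) (auto simp: g_def)
      ultimately have "g integrable_on K"
        using x unfolding K by (auto intro: Henstock_Kurzweil_Integration.integrable_combine[of u x])
      moreover have "norm (f y - g y) \<le> e" if "y \<in> K" for y
      proof -
        have "\<bar>y - x\<bar> < d x" "y \<in> {a..b}"
          using that ball sub by (auto simp: dist_real_def)
        then show ?thesis
          using lr[OF xab, of y] \<open>e > 0\<close> by (cases y x rule: linorder_cases) (simp_all add: g_def)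
      qed
      ultimately show ?thesis by blast
    qed
    then have steps: "\<forall>K\<in>snd ` p. \<exists>g. (\<forall>x\<in>K. norm (f x - g x) \<le> e) \<and> g integrable_on K"
      by blast
    have "snd ` p division_of cbox a b"
      using division_of_tagged_division[OF p] by simp
    from approximable_on_division[OF less_imp_le[OF \<open>e > 0\<close>] this steps] show ?thesis
      by blast
  qed
  from integrable_uniform_limit[of a b f, OF this] show ?thesis
    by simp
qed

section \<open>Jump operators\<close>

lemma fwd_jump_ge:
  assumes "t \<in> T"
  shows "t \<le> fwd_jump T t"
proof (cases "{s \<in> T. s > t} = {}")
  case True
  then have "Sup T = t"
    using assms by (intro cSup_eq_maximum) (auto simp: not_less)
  then show ?thesis
    using True by (simp add: fwd_jump_def)
next
  case False
  then show ?thesis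
    unfolding fwd_jump_def by (auto intro!: cInf_greatest)
qed

lemma fwd_jump_le:
  assumes "s \<in> T" "t < s"
  shows "fwd_jump T t \<le> s"
proof -
  have "bdd_below {s \<in> T. s > t}"
    by (rule bdd_belowI[of _ t]) auto
  then show ?thesis
    using assms unfolding fwd_jump_def by (auto intro!: cInf_lower)
qed

lemma fwd_jump_mem:
  assumes "closed T" "t \<in> T"
  shows "fwd_jump T t \<in> T"
proof (cases "{s \<in> T. s > t} = {}")
  case True
  then have "Sup T = t"
    using assms by (intro cSup_eq_maximum) (auto simp: not_less)
  then show ?thesis
    using True assms by (simp add: fwd_jump_def)
next
  case False
  have "Inf {s \<in> T. s > t} \<in> closure {s \<in> T. s > t}"
    by (rule closure_contains_Inf) (use False in \<open>auto intro!: bdd_belowI[of _ t]\<close>)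
  also have "\<dots> \<subseteq> T"
    using assms by (intro closure_minimal) auto
  finally show ?thesis
    unfolding fwd_jump_def if_not_P[OF False] .
qed

text \<open>The point \<open>s\<close> rules out the default value \<open>Sup T\<close> of
  \<open>fwd_jump\<close>, by which a maximum of \<open>T\<close> counts as right-dense with no
  point of \<open>T\<close> to its right.\<close>

lemma right_dense_approx:
  assumes "right_dense T t" "s \<in> T" "t < s" "t < x"
  shows "\<exists>u\<in>T. t < u \<and> u < x"
proof (rule ccontr)
  assume "\<not> ?thesis"
  then have "x \<le> Inf {s \<in> T. s > t}"
    using assms by (intro cInf_greatest) (auto simp: not_less)
  also have "\<dots> = t"
    using assms by (auto simp: right_dense_def fwd_jump_def split: if_splits)
  finally show False
    using assms by simp
qed

text \<open>Here \<open>s\<close> rules out the default \<open>Inf T\<close>, so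
  \<open>bwd_jump T t\<close> is a genuine supremum of points below \<open>t\<close>.\<close>

lemma left_dense_approx:
  assumes "bwd_jump T t \<ge> t" "s \<in> T" "s < t" "x < t"
  shows "\<exists>u\<in>T. x < u \<and> u < t"
proof (rule ccontr)
  assume "\<not> ?thesis"
  then have "Sup {s \<in> T. s < t} \<le> x"
    using assms by (intro cSup_least) (auto simp: not_less)
  then show False
    using assms by (auto simp: bwd_jump_def split: if_splits)
qed

lemma bwd_jump_le:
  assumes "s \<in> T" "s < t"
  shows "bwd_jump T t \<le> t"
  using assms unfolding bwd_jump_def by (auto intro!: cSup_least)

lemma bwd_jump_ge:
  assumes "s \<in> T" "s < t"
  shows "s \<le> bwd_jump T t"
proof -
  have "bdd_above {s \<in> T. s < t}"
    by (rule bdd_aboveI[of _ t]) auto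
  then show ?thesis
    using assms unfolding bwd_jump_def by (auto intro!: cSup_upper)
qed

lemma bwd_jump_mem:
  assumes "closed T" "s \<in> T" "s < t"
  shows "bwd_jump T t \<in> T"
proof -
  have "Sup {s \<in> T. s < t} \<in> closure {s \<in> T. s < t}"
    by (rule closure_contains_Sup) (use assms in \<open>auto intro!: bdd_aboveI[of _ t]\<close>)
  also have "\<dots> \<subseteq> T"
    using assms by (intro closure_minimal) auto
  finally show ?thesis
    using assms by (auto simp: bwd_jump_def)
qed

section \<open>Calculus of delta derivatives\<close>

text \<open>The filter of the delta derivative gets a name because continuity at \<open>t\<close> is
  needed along this same filter.\<close>

definition delta_at :: "real set \<Rightarrow> real \<Rightarrow> real filter" where
  "delta_at T t = inf (nhds t) (principal (T - {fwd_jump T t}))"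

lemma has_delta_derivative_iff:
  "has_delta_derivative T f D t \<longleftrightarrow>
    ((\<lambda>s. (f (fwd_jump T t) - f s) / complex_of_real (fwd_jump T t - s)) \<longlongrightarrow> D) (delta_at T t)"
  by (simp add: has_delta_derivative_def delta_at_def)

lemma eventually_delta_at:
  "eventually P (delta_at T t) \<longleftrightarrow>
    (\<exists>d>0. \<forall>s\<in>T. s \<noteq> fwd_jump T t \<longrightarrow> \<bar>s - t\<bar> < d \<longrightarrow> P s)"
  by (auto simp: delta_at_def eventually_inf_principal eventually_nhds_metric dist_real_def)

lemma eventually_delta_at_mem: "eventually (\<lambda>s. s \<in> T \<and> s \<noteq> fwd_jump T t) (delta_at T t)"
  by (auto simp: eventually_delta_at intro: exI[of _ 1])

lemma tendsto_delta_at_ident: "((\<lambda>s. s) \<longlongrightarrow> t) (delta_at T t)"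
  unfolding delta_at_def by (rule filterlim_mono[OF filterlim_ident order_refl inf_le1])

text \<open>A right-scattered \<open>t\<close> itself satisfies
  \<open>s \<noteq> \<sigma>(t)\<close> and lies in each of its neighbourhoods, so a limit along the
  filter must respect the value at \<open>t\<close>.\<close>

lemma delta_at_tendsto_scattered:
  fixes f :: "real \<Rightarrow> 'a::t1_space"
  assumes "t \<in> T" "fwd_jump T t \<noteq> t" "(f \<longlongrightarrow> L) (delta_at T t)"
  shows "f t = L"
proof (rule ccontr)
  assume "f t \<noteq> L"
  then obtain U where "open U" "L \<in> U" "f t \<notin> U"
    by (metis t1_space)
  then have "eventually (\<lambda>s. f s \<in> U) (delta_at T t)"
    using assms(3) topological_tendstoD by blast
  then have "f t \<in> U"
    using assms(1,2) unfolding eventually_delta_at by force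
  then show False
    using \<open>f t \<notin> U\<close> by simp
qed

lemma delta_derivative_imp_tendsto:
  assumes "t \<in> T" "has_delta_derivative T f D t"
  shows "(f \<longlongrightarrow> f t) (delta_at T t)"
proof -
  let ?\<sigma> = "fwd_jump T t"
  have "((\<lambda>s. f ?\<sigma> - complex_of_real (?\<sigma> - s) *
      ((f ?\<sigma> - f s) / complex_of_real (?\<sigma> - s))) \<longlongrightarrow>
      f ?\<sigma> - complex_of_real (?\<sigma> - t) * D) (delta_at T t)"
    by (intro tendsto_intros tendsto_delta_at_ident
        assms(2)[unfolded has_delta_derivative_iff])
  then have lim: "(f \<longlongrightarrow> f ?\<sigma> - complex_of_real (?\<sigma> - t) * D) (delta_at T t)"
    by (rule Lim_transform_eventually)
      (use eventually_delta_at_mem in eventually_elim, auto)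
  show ?thesis
  proof (cases "?\<sigma> = t")
    case False
    then show ?thesis
      using delta_at_tendsto_scattered[OF assms(1) False lim] lim by simp
  qed (use lim in simp)
qed

lemma delta_derivative_scattered:
  assumes "t \<in> T" "fwd_jump T t \<noteq> t" "has_delta_derivative T f D t"
  shows "f (fwd_jump T t) - f t = complex_of_real (graininess T t) * D"
  using delta_at_tendsto_scattered[OF assms(1,2) assms(3)[unfolded has_delta_derivative_iff]] assms(2)
  by (auto simp: graininess_def)

text \<open>At a right-scattered \<open>t\<close> the denominator tends to the nonzero
  \<open>\<mu>(t)\<close>, so continuity alone makes the quotient converge, to the slope across the
  gap.\<close>

lemma has_delta_derivative_scattered:
  assumes "t \<in> T" "fwd_jump T t \<noteq> t" "(f \<longlongrightarrow> f t) (delta_at T t)"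
    and "f (fwd_jump T t) - f t = complex_of_real (graininess T t) * D"
  shows "has_delta_derivative T f D t"
proof -
  have "((\<lambda>s. (f (fwd_jump T t) - f s) / complex_of_real (fwd_jump T t - s)) \<longlongrightarrow>
     (f (fwd_jump T t) - f t) / complex_of_real (fwd_jump T t - t)) (delta_at T t)"
    using assms(2) by (intro tendsto_intros assms(3) tendsto_delta_at_ident) auto
  then show ?thesis
    using assms(2,4) by (simp add: has_delta_derivative_iff graininess_def)
qed


lemma has_delta_derivative_linear:
  assumes "has_delta_derivative T f D t" "has_delta_derivative T g E t"
  shows "has_delta_derivative T (\<lambda>s. a * f s + b * g s) (a * D + b * E) t"
proof -
  have "((\<lambda>s. a * ((f (fwd_jump T t) - f s) / complex_of_real (fwd_jump T t - s)) +
       b * ((g (fwd_jump T t) - g s) / complex_of_real (fwd_jump T t - s))) \<longlongrightarrow> a * D + b * E)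
      (delta_at T t)"
    by (intro tendsto_intros assms[unfolded has_delta_derivative_iff])
  then show ?thesis
    by (simp add: has_delta_derivative_iff algebra_simps diff_divide_distrib add_divide_distrib)
qed

lemma has_delta_derivative_cnj:
  assumes "has_delta_derivative T f D t"
  shows "has_delta_derivative T (\<lambda>s. cnj (f s)) (cnj D) t"
  using tendsto_cnj[OF assms[unfolded has_delta_derivative_iff]]
  by (simp add: has_delta_derivative_iff)

text \<open>Intended for \<open>cayley_exp\<close>, which is identified with the exponential of an
  antiderivative on \<open>T\<close> only; closedness puts \<open>\<sigma>(t)\<close> into
  \<open>T\<close>.\<close>

lemma has_delta_derivative_cong:
  assumes "closed T" "t \<in> T" "\<And>s. s \<in> T \<Longrightarrow> f s = g s" "has_delta_derivative T f D t"
  shows "has_delta_derivative T g D t"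
proof -
  have "eventually (\<lambda>s. (f (fwd_jump T t) - f s) / complex_of_real (fwd_jump T t - s) =
     (g (fwd_jump T t) - g s) / complex_of_real (fwd_jump T t - s)) (delta_at T t)"
    using eventually_delta_at_mem
    by eventually_elim (simp add: assms(3) fwd_jump_mem[OF assms(1,2)])
  then show ?thesis
    using assms(4) unfolding has_delta_derivative_iff by (rule tendsto_cong[THEN iffD1])
qed

text \<open>The symmetric splitting of \<open>f(\<sigma>(t)) g(\<sigma>(t)) - f(s) g(s)\<close> is
  exact for every \<open>s\<close>; the limit then uses continuity of \<open>f\<close> and
  \<open>g\<close> along the filter.\<close>

lemma has_delta_derivative_mult:
  assumes "t \<in> T" "has_delta_derivative T f D t" "has_delta_derivative T g E t"
  shows "has_delta_derivative T (\<lambda>s. f s * g s) (D * jump_avg T g t + jump_avg T f t * E) t"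
proof -
  let ?\<sigma> = "fwd_jump T t"
  have "((\<lambda>s. (f ?\<sigma> - f s) / complex_of_real (?\<sigma> - s) * ((g s + g ?\<sigma>) / 2) +
      (f s + f ?\<sigma>) / 2 * ((g ?\<sigma> - g s) / complex_of_real (?\<sigma> - s))) \<longlongrightarrow>
      D * ((g t + g ?\<sigma>) / 2) + (f t + f ?\<sigma>) / 2 * E) (delta_at T t)"
    by (intro tendsto_intros assms(2,3)[unfolded has_delta_derivative_iff]
        delta_derivative_imp_tendsto[OF assms(1,2)] delta_derivative_imp_tendsto[OF assms(1,3)]) auto
  moreover have "(f ?\<sigma> - f s) / c * ((g s + g ?\<sigma>) / 2) + (f s + f ?\<sigma>) / 2 * ((g ?\<sigma> - g s) / c) =
      (f ?\<sigma> * g ?\<sigma> - f s * g s) / c" for s c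
    by (cases "c = 0") (simp_all add: field_simps)
  ultimately show ?thesis
    unfolding has_delta_derivative_iff jump_avg_def by (simp only:)
qed

section \<open>Vanishing delta derivatives and uniqueness of the delta integral\<close>

lemma delta_derivative_zero_bound:
  assumes "closed T" "a \<in> T" "b \<in> T" "a \<le> b" "e > 0"
    and deriv: "\<And>t. t \<in> kappa T \<Longrightarrow> has_delta_derivative T H 0 t"
  shows "norm (H b - H a) \<le> e * (b - a)"
proof (rule ccontr)
  \<comment> \<open>The infimum \<open>c\<close> of the set \<open>B\<close> of violations satisfies the bound itself, so \<open>B\<close>
    accumulates at \<open>c\<close> from the right, which the derivative at the right-dense point \<open>c\<close> forbids.\<close>
  define B where "B = {s \<in> T. a \<le> s \<and> s \<le> b \<and> norm (H s - H a) > e * (s - a)}"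
  define c where "c = Inf B"
  assume "\<not> ?thesis"
  then have bB: "b \<in> B"
    using assms by (simp add: B_def)
  have bdd: "bdd_below B"
    by (auto simp: B_def intro: bdd_belowI[of _ a])
  have "c \<in> closure B"
    unfolding c_def using bB bdd by (intro closure_contains_Inf) auto
  also have "closure B \<subseteq> T \<inter> {a..b}"
    using \<open>closed T\<close> by (intro closure_minimal) (auto simp: B_def)
  finally have c: "c \<in> T" "a \<le> c" "c \<le> b"
    by auto
  have below: "norm (H s - H a) \<le> e * (s - a)" if "s \<in> T" "a \<le> s" "s < c" for s
  proof (rule ccontr)
    assume "\<not> ?thesis"
    then have "s \<in> B"
      using that c by (simp add: B_def)
    from cInf_lower[OF this bdd] show False
      using that by (simp add: c_def)
  qed
  \<comment> \<open>If \<open>c\<close> is left-scattered, its predecessor \<open>r\<close> has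
    \<open>\<sigma>(r) = c\<close>, and a zero derivative across the gap gives
    \<open>H c = H r\<close>. If \<open>c\<close> is left-dense, continuity carries the bound over
    from points below \<open>c\<close>.\<close>
  have c_good: "norm (H c - H a) \<le> e * (c - a)"
  proof (cases "a = c")
    case False
    then have "a < c"
      using c by simp
    define r where "r = bwd_jump T c"
    have r: "r \<in> T" "a \<le> r" "r \<le> c"
      unfolding r_def using bwd_jump_mem[OF assms(1,2) \<open>a < c\<close>] bwd_jump_ge[OF assms(2) \<open>a < c\<close>]
      bwd_jump_le[OF assms(2) \<open>a < c\<close>] by simp_all
    show ?thesis
    proof (cases "r < c")
      case True
      have gap: "u \<le> r" if "u \<in> T" "u < c" for u
        using bwd_jump_ge[OF that] by (simp add: r_def)
      have \<sigma>: "fwd_jump T r = c"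
      proof (rule ccontr)
        assume "fwd_jump T r \<noteq> c"
        then have "fwd_jump T r < c"
          using fwd_jump_le[OF c(1) True] by simp
        then have "fwd_jump T r = r"
          using gap fwd_jump_mem[OF assms(1) r(1)] fwd_jump_ge[OF r(1)] by (simp add: eq_iff)
        then obtain u where "u \<in> T" "r < u" "u < c"
          using right_dense_approx[OF _ c(1) True True] by (auto simp: right_dense_def)
        then show False
          using gap by force
      qed
      have "r \<in> kappa T"
        using r True c by (auto simp: kappa_def not_le)
      from delta_derivative_scattered[OF r(1) _ deriv[OF this]] have "H c = H r"
        using \<sigma> True by simp
      moreover have "e * (r - a) \<le> e * (c - a)"
        using r \<open>e > 0\<close> by simp
      ultimately show ?thesis
        using below[OF r(1,2) True] by simp
    next
      case False
      then have "r = c"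
        using r by simp
      \<comment> \<open>A point that is not left-scattered stays in \<open>kappa T\<close> even if
        it is the maximum of \<open>T\<close>.\<close>
      then have "c \<in> kappa T"
        using c by (auto simp: kappa_def left_scattered_def r_def)
      note lim = delta_derivative_imp_tendsto[OF c(1) deriv[OF this]]
      show ?thesis
      proof (rule ccontr)
        assume "\<not> ?thesis"
        then have "0 < norm (H c - H a) - e * (c - a)"
          by simp
        moreover have "((\<lambda>s. norm (H s - H a) - e * (s - a)) \<longlongrightarrow>
            norm (H c - H a) - e * (c - a)) (delta_at T c)"
          by (intro tendsto_intros lim tendsto_delta_at_ident)
        ultimately have "eventually (\<lambda>s. 0 < norm (H s - H a) - e * (s - a)) (delta_at T c)"
          by (rule order_tendstoD(1)[rotated])
        then obtain d where d: "d > 0" "\<And>s. s \<in> T \<Longrightarrow> s \<noteq> fwd_jump T c \<Longrightarrow> \<bar>s - c\<bar> < d \<Longrightarrow>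
            0 < norm (H s - H a) - e * (s - a)"
          unfolding eventually_delta_at by blast
        obtain u where u: "u \<in> T" "max a (c - d) < u" "u < c"
          using left_dense_approx[of c T a "max a (c - d)"] \<open>r = c\<close> \<open>a < c\<close> d(1) assms(2)
          by (auto simp: r_def)
        then show False
          using d(2)[of u] below[of u] fwd_jump_ge[OF c(1)] by auto
      qed
    qed
  qed auto
  then have "c \<notin> B"
    by (auto simp: B_def)
  then have "c < b"
    using bB c by (cases "c = b") auto
  have above: "\<exists>u\<in>B. c < u \<and> u < x" if "c < x" for x
  proof -
    have "B \<noteq> {}"
      using bB by blast
    then obtain u where "u \<in> B" "u < x"
      using cInf_lessD[of B x] \<open>c < x\<close> unfolding c_def by blast
    moreover have "c \<le> u"
      unfolding c_def using \<open>u \<in> B\<close> bdd by (rule cInf_lower)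
    ultimately show ?thesis
      using \<open>c \<notin> B\<close> by (metis order_le_less)
  qed
  have \<sigma>: "fwd_jump T c = c"
  proof (rule ccontr)
    assume "fwd_jump T c \<noteq> c"
    then have "c < fwd_jump T c"
      using fwd_jump_ge[OF c(1)] by simp
    from above[OF this] show False
      using fwd_jump_le[of _ T c] by (force simp: B_def)
  qed
  have "c \<in> kappa T"
    using c \<open>c < b\<close> assms(3) by (auto simp: kappa_def not_le)
  \<comment> \<open>The slope of \<open>H\<close> from \<open>c\<close> to a nearby violation
    \<open>u\<close> is below \<open>e\<close>; added to the bound at \<open>c\<close>, this gives
    the bound at \<open>u\<close>.\<close>
  from tendstoD[OF deriv[OF this, unfolded has_delta_derivative_iff] \<open>e > 0\<close>]
  obtain d where d: "d > 0"
    "\<And>s. s \<in> T \<Longrightarrow> s \<noteq> c \<Longrightarrow> \<bar>s - c\<bar> < d \<Longrightarrow> norm ((H c - H s) / complex_of_real (c - s)) < e"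
    unfolding eventually_delta_at \<sigma> by auto
  obtain u where u: "u \<in> B" "c < u" "u < c + d"
    using above[of "c + d"] d(1) by auto
  then have "norm (H c - H u) < e * (u - c)"
    using d(2)[of u] by (auto simp: B_def norm_divide field_simps simp flip: of_real_diff)
  then have "norm (H u - H a) \<le> e * (u - c) + e * (c - a)"
    using norm_triangle_ineq[of "H u - H c" "H c - H a"] c_good by (simp add: norm_minus_commute)
  then show False
    using u(1) by (simp add: B_def algebra_simps)
qed

text \<open>Serves twice: for the uniqueness of delta integrals and for the conserved product in
  \<open>cayley_mult_const\<close>.\<close>

lemma delta_derivative_zero_imp_const:
  assumes "closed T" "a \<in> T" "b \<in> T"
    and deriv: "\<And>t. t \<in> kappa T \<Longrightarrow> has_delta_derivative T H 0 t"
  shows "H a = H b"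
proof -
  have *: "H a = H b" if "a \<in> T" "b \<in> T" "a < b" for a b
  proof (rule ccontr)
    assume "H a \<noteq> H b"
    then have "norm (H b - H a) > 0"
      by simp
    define d where "d = b - a"
    have "d > 0"
      using \<open>a < b\<close> by (simp add: d_def)
    \<comment> \<open>This choice of \<open>e\<close> makes the bound equal to half of the norm
      being bounded.\<close>
    have "norm (H b - H a) \<le> norm (H b - H a) / (2 * d) * d"
      unfolding d_def using that \<open>norm (H b - H a) > 0\<close>
      by (intro delta_derivative_zero_bound[OF assms(1)] deriv) auto
    then show False
      using \<open>norm (H b - H a) > 0\<close> \<open>d > 0\<close> by simp
  qed
  show ?thesis
    using * assms(2,3) by (metis linorder_neqE)
qed

text \<open>Two antiderivatives differ by a constant on \<open>T\<close>, so the definite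
  description in \<open>delta_integral\<close> denotes.\<close>

lemma delta_integral_eq:
  assumes "closed T" "a \<in> T" "b \<in> T" "delta_antiderivative T f F"
  shows "delta_integral T a b f = F b - F a"
  unfolding delta_integral_def
proof (rule the_equality)
  fix I
  assume "\<exists>G. delta_antiderivative T f G \<and> I = G b - G a"
  then obtain G where G: "delta_antiderivative T f G" "I = G b - G a"
    by blast
  have "has_delta_derivative T (\<lambda>s. 1 * G s + (-1) * F s) 0 t" if "t \<in> kappa T" for t
    using has_delta_derivative_linear[of T G "f t" t F "f t" 1 "-1"] G(1) assms(4) that
    by (simp add: delta_antiderivative_def)
  from delta_derivative_zero_imp_const[OF assms(1-3) this] show "I = F b - F a"
    unfolding G(2) by (simp add: algebra_simps)
qed (use assms in blast)

section \<open>Existence of delta antiderivatives\<close>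

text \<open>Points of a gap are sent to its left endpoint, so that the ordinary integral of
  \<open>f(floor_pt T x)\<close> from \<open>t\<close> to \<open>\<sigma>(t)\<close> is
  \<open>\<mu>(t) f(t)\<close>, as the delta integral demands.\<close>

definition floor_pt :: "real set \<Rightarrow> real \<Rightarrow> real" where
  "floor_pt T x = Sup {s \<in> T. s \<le> x}"

lemma floor_pt:
  assumes "closed T" "a \<in> T" "a \<le> x"
  shows "floor_pt T x \<in> T" "floor_pt T x \<le> x"
proof -
  have "floor_pt T x \<in> closure {s \<in> T. s \<le> x}"
    unfolding floor_pt_def by (rule closure_contains_Sup) (use assms in \<open>auto intro!: bdd_aboveI[of _ x]\<close>)
  also have "\<dots> \<subseteq> T \<inter> {..x}"
    using assms by (intro closure_minimal) auto
  finally show "floor_pt T x \<in> T" "floor_pt T x \<le> x"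
    by auto
qed

lemma floor_pt_ge:
  assumes "s \<in> T" "s \<le> x"
  shows "s \<le> floor_pt T x"
  unfolding floor_pt_def by (rule cSup_upper) (use assms in \<open>auto intro!: bdd_aboveI[of _ x]\<close>)

text \<open>On each side of \<open>x\<close>, either \<open>floor_pt\<close> is locally constant or
  \<open>x\<close> is a point of \<open>T\<close> dense on that side, where rd-continuity supplies
  the limit.\<close>

lemma rd_continuous_imp_integrable:
  assumes "closed T" "rd_continuous T f" "a \<in> T"
  shows "(\<lambda>x. f (floor_pt T x)) integrable_on {a..b}"
proof (rule regulated_imp_integrable)
  fix x assume x: "a < x" "x \<le> b"
  \<comment> \<open>The point \<open>x\<close> need not lie in \<open>T\<close>; since
    \<open>a\<close> lies below it, \<open>r\<close> is the supremum of the points of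
    \<open>T\<close> below \<open>x\<close>.\<close>
  define r where "r = bwd_jump T x"
  have r: "r \<in> T" "a \<le> r" "r \<le> x"
    unfolding r_def using bwd_jump_mem[OF assms(1,3) x(1)] bwd_jump_ge[OF assms(3) x(1)]
      bwd_jump_le[OF assms(3) x(1)] by simp_all
  show "\<exists>l. ((\<lambda>x. f (floor_pt T x)) \<longlongrightarrow> l) (at_left x)"
  proof (cases "r < x")
    case True
    have "floor_pt T y = r" if "r < y" "y < x" for y
      using that floor_pt[OF assms(1) r(1), of y] floor_pt_ge[OF r(1), of y]
        bwd_jump_ge[of "floor_pt T y" T x] by (simp add: r_def)
    then have "eventually (\<lambda>y. f (floor_pt T y) = f r) (at_left x)"
      using True by (auto simp: eventually_at_left_field)
    then have "((\<lambda>y. f (floor_pt T y)) \<longlongrightarrow> f (r)) (at_left x)"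
      by (rule tendsto_eventually)
    then show ?thesis
      by blast
  next
    case False
    then have "r = x" "x \<in> T"
      using r by auto
    then obtain l where l: "(f \<longlongrightarrow> l) (at x within (T \<inter> {..<x}))"
      using assms(2) by (auto simp: rd_continuous_def left_dense_def r_def)
    have floor: "floor_pt T y \<in> T" "floor_pt T y < x" if "a < y" "y < x" for y
      using floor_pt[OF assms(1,3), of y] that by auto
    \<comment> \<open>Staying strictly below \<open>x\<close> matters: the left-hand limit
      \<open>l\<close> may differ from \<open>f x\<close>.\<close>
    have "filterlim (floor_pt T) (at x within (T \<inter> {..<x})) (at_left x)"
      unfolding filterlim_at
    proof (intro conjI order_tendstoI)
      show "eventually (\<lambda>y. floor_pt T y \<in> T \<inter> {..<x} \<and> floor_pt T y \<noteq> x) (at_left x)"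
        by (rule eventually_at_leftI[OF _ x(1)]) (use floor in force)
    next
      fix z assume "z < x"
      then obtain u where u: "u \<in> T" "z < u" "u < x"
        using left_dense_approx[of x T a z] \<open>r = x\<close> assms(3) x(1) by (auto simp: r_def)
      then show "eventually (\<lambda>y. z < floor_pt T y) (at_left x)"
        using less_le_trans[OF u(2) floor_pt_ge[OF u(1)]]
        by (intro eventually_at_leftI[OF _ u(3)]) simp
    next
      fix z assume "x < z"
      then show "eventually (\<lambda>y. floor_pt T y < z) (at_left x)"
        using floor by (intro eventually_at_leftI[OF _ x(1)]) force
    qed
    from filterlim_compose[OF l this] show ?thesis
      by blast
  qed
next
  fix x assume x: "a \<le> x" "x < b"
  show "\<exists>l. ((\<lambda>x. f (floor_pt T x)) \<longlongrightarrow> l) (at_right x)"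
  \<comment> \<open>The first case includes every \<open>x\<close> with no point of \<open>T\<close>
    to its right, so a maximum is treated like the start of a gap.\<close>
  proof (cases "\<exists>z>x. \<forall>u\<in>T. x < u \<longrightarrow> z \<le> u")
    case True
    then obtain z where z: "z > x" "\<And>u. u \<in> T \<Longrightarrow> x < u \<Longrightarrow> z \<le> u"
      by blast
    have "floor_pt T y = floor_pt T x" if "x < y" "y < z" for y
    proof (rule antisym)
      have "floor_pt T y \<in> T" "floor_pt T y \<le> y"
        using floor_pt[OF assms(1,3), of y] x(1) that(1) by simp_all
      moreover from this have "floor_pt T y \<le> x"
        using z(2)[of "floor_pt T y"] that by (meson le_less_trans not_le)
      ultimately show "floor_pt T y \<le> floor_pt T x"
        by (intro floor_pt_ge)
      show "floor_pt T x \<le> floor_pt T y"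
        using floor_pt[OF assms(1,3) x(1)] that by (intro floor_pt_ge) auto
    qed
    then have "eventually (\<lambda>y. f (floor_pt T y) = f (floor_pt T x)) (at_right x)"
      using z(1) by (auto simp: eventually_at_right_field)
    then have "((\<lambda>y. f (floor_pt T y)) \<longlongrightarrow> f (floor_pt T x)) (at_right x)"
      by (rule tendsto_eventually)
    then show ?thesis
      by blast
  next
    case False
    then have ex: "\<exists>u\<in>T. x < u \<and> u < z" if "z > x" for z
      using that by (force simp: not_le)
    have "x islimpt T"
      unfolding islimpt_approachable
    proof (intro allI impI)
      fix e :: real assume "e > 0"
      then show "\<exists>x'\<in>T. x' \<noteq> x \<and> dist x' x < e"
        using ex[of "x + e"] by (auto simp: dist_real_def)
    qed
    then have "x \<in> T"
      using assms(1) closed_limpt by blast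
    have "\<not> x < fwd_jump T x"
      using ex fwd_jump_le[of _ T x] by force
    then have "right_dense T x"
      using fwd_jump_ge[OF \<open>x \<in> T\<close>] by (simp add: right_dense_def)
    then have cont: "continuous (at x within T) f"
      using assms(2) \<open>x \<in> T\<close> by (simp add: rd_continuous_def)
    have "((\<lambda>y. f (floor_pt T y)) \<longlongrightarrow> f x) (at_right x)"
    proof (rule tendstoI)
      fix e :: real assume "e > 0"
      then obtain d where d: "d > 0" "\<And>y. y \<in> T \<Longrightarrow> dist y x < d \<Longrightarrow> dist (f y) (f x) < e"
        using cont unfolding continuous_within_eps_delta by blast
      have "dist (f (floor_pt T y)) (f x) < e" if "x < y" "y < x + d" for y
        using d(2)[of "floor_pt T y"] floor_pt[OF assms(1) \<open>x \<in> T\<close>, of y] 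
          floor_pt_ge[OF \<open>x \<in> T\<close>, of y] that by (simp add: dist_real_def)
      then show "eventually (\<lambda>y. dist (f (floor_pt T y)) (f x) < e) (at_right x)"
        using d(1) by (auto simp: eventually_at_right_field intro: exI[of _ "x + d"])
    qed
    then show ?thesis by blast
  qed
qed

text \<open>\<open>F\<close> is the signed integral of the extension \<open>h\<close> from a base
  point \<open>c\<close>. Right-dense points follow the usual proof of the fundamental theorem; at
  right-scattered points the integral over the gap is exact, and continuity of \<open>F\<close>
  remains to be shown.\<close>

lemma rd_continuous_imp_antiderivative:
  assumes T: "closed T" "T \<noteq> {}" and rd: "rd_continuous T f"
  shows "\<exists>F. delta_antiderivative T f F"
proof -
  obtain c where c: "c \<in> T"
    using T by blast
  define h where "h = (\<lambda>x. f (floor_pt T x))"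
  define F where "F = (\<lambda>t. if c \<le> t then integral {c..t} h else - integral {t..c} h)"
  have int: "h integrable_on {a..b}" if "a \<in> T" for a b
    unfolding h_def by (rule rd_continuous_imp_integrable[OF T(1) rd that])
  have F_diff: "F t - F s = integral {s..t} h" if "s \<in> T" "t \<in> T" "s \<le> t" for s t
  proof -
    consider "c \<le> s" | "s < c" "c \<le> t" | "t < c"
      by linarith
    then show ?thesis
    proof cases
      case 1
      then show ?thesis
        using Henstock_Kurzweil_Integration.integral_combine[OF 1 that(3) int[OF c]] that(3) by (simp add: F_def algebra_simps)
    next
      case 2
      then show ?thesis
        using Henstock_Kurzweil_Integration.integral_combine[OF _ 2(2) int[OF that(1)]] by (simp add: F_def algebra_simps)
    next
      case 3
      then show ?thesis
        using Henstock_Kurzweil_Integration.integral_combine[OF that(3) _ int[OF that(1)], of c] that(3)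
        by (simp add: F_def algebra_simps)
    qed
  qed
  \<comment> \<open>Only values of \<open>f\<close> on \<open>T\<close> within \<open>[s, t)\<close>
    enter, since \<open>floor_pt\<close> maps this interval into itself; the endpoint
    \<open>t\<close> is discarded as a null set.\<close>
  have est: "norm (F t - F s - complex_of_real (t - s) * v) \<le> e * (t - s)"
    if st: "s \<in> T" "t \<in> T" "s \<le> t" and "e \<ge> 0"
      and bound: "\<And>x. x \<in> T \<Longrightarrow> s \<le> x \<Longrightarrow> x < t \<Longrightarrow> norm (f x - v) \<le> e" for s t v e
  proof -
    have "((\<lambda>x. v) has_integral (t - s) *\<^sub>R v) {s..t}"
      using has_integral_const_real[of v s t] st(3) by simp
    then have "((\<lambda>x. h x - v) has_integral (integral {s..t} h - (t - s) *\<^sub>R v)) {s..t}"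
      by (intro has_integral_diff integrable_integral int st(1))
    moreover have "norm (h x - v) \<le> e" if "x \<in> {s..t} - {t}" for x
      unfolding h_def using that floor_pt[OF T(1) st(1), of x] floor_pt_ge[OF st(1), of x]
      by (intro bound) auto
    ultimately have "norm (integral {s..t} h - (t - s) *\<^sub>R v) \<le> e * (t - s)"
      using has_integral_bound_real[OF \<open>e \<ge> 0\<close>, of "{t}" "\<lambda>x. h x - v" _ s t] st(3) by simp
    then show ?thesis
      using st by (simp add: F_diff scaleR_conv_of_real)
  qed
  have "has_delta_derivative T F (f t) t" if t: "t \<in> T" for t
  proof (cases "fwd_jump T t = t")
    case True
    then have cont: "continuous (at t within T) f"
      using rd t by (simp add: rd_continuous_def right_dense_def)
    show ?thesis
      unfolding has_delta_derivative_iff True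
    proof (rule tendstoI)
      fix e :: real assume "e > 0"
      then obtain d where d: "d > 0" "\<And>s. s \<in> T \<Longrightarrow> dist s t < d \<Longrightarrow> dist (f s) (f t) < e / 2"
        using cont unfolding continuous_within_eps_delta by (meson half_gt_zero)
      have "dist ((F t - F s) / complex_of_real (t - s)) (f t) < e"
        if s: "s \<in> T" "s \<noteq> t" "\<bar>s - t\<bar> < d" for s
      proof -
        have *: "norm (F t - F s - complex_of_real (t - s) * f t) \<le> e / 2 * \<bar>t - s\<bar>"
        proof (cases "s < t")
          case True
          have "norm (F t - F s - complex_of_real (t - s) * f t) \<le> e / 2 * (t - s)"
            using True s t \<open>e > 0\<close> d(2)
            by (intro est) (auto simp: dist_norm intro!: less_imp_le)
          then show ?thesis
            using True by simp
        next
          case False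
          have "norm (F s - F t - complex_of_real (s - t) * f t) \<le> e / 2 * (s - t)"
            using False s t \<open>e > 0\<close> d(2)
            by (intro est) (auto simp: dist_norm intro!: less_imp_le)
          also have "norm (F s - F t - complex_of_real (s - t) * f t) =
              norm (F t - F s - complex_of_real (t - s) * f t)"
            by (subst norm_minus_cancel[symmetric]) (simp add: algebra_simps)
          finally show ?thesis
            using False by simp
        qed
        have "(F t - F s) / complex_of_real (t - s) - f t =
            (F t - F s - complex_of_real (t - s) * f t) / complex_of_real (t - s)"
          using s(2) by (simp add: field_simps)
        then have "norm ((F t - F s) / complex_of_real (t - s) - f t) =
            norm (F t - F s - complex_of_real (t - s) * f t) / \<bar>t - s\<bar>"
          by (simp add: norm_divide flip: of_real_diff)
        also have "\<dots> \<le> e / 2"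
          using * s(2) by (simp add: divide_le_eq)
        finally show ?thesis
          using \<open>e > 0\<close> by (simp add: dist_norm)
      qed
      then show "eventually (\<lambda>s. dist ((F t - F s) / complex_of_real (t - s)) (f t) < e) (delta_at T t)"
        unfolding eventually_delta_at using d(1) True by auto
    qed
  next
    case False
    define \<sigma> where "\<sigma> = fwd_jump T t"
    have \<sigma>: "\<sigma> \<in> T" "t < \<sigma>"
      using fwd_jump_mem[OF T(1) t] fwd_jump_ge[OF t] False by (auto simp: \<sigma>_def)
    have gap: "x \<le> t" if "x \<in> T" "x < \<sigma>" for x
      using fwd_jump_le[of x T t] that by (force simp: \<sigma>_def not_le[symmetric])
    \<comment> \<open>The only point of \<open>T\<close> in \<open>[t, \<sigma>)\<close> is
      \<open>t\<close>, so \<open>est\<close> applies with error \<open>0\<close>.\<close>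
    have "norm (F \<sigma> - F t - complex_of_real (\<sigma> - t) * f t) \<le> 0 * (\<sigma> - t)"
      using t \<sigma> gap by (intro est) force+
    then have jump: "F \<sigma> - F t = complex_of_real (graininess T t) * f t"
      by (simp add: graininess_def \<sigma>_def)
    have "(F \<longlongrightarrow> F t) (delta_at T t)"
    proof (rule tendstoI)
      fix e :: real assume "e > 0"
      \<comment> \<open>Because of the gap, points of \<open>T\<close> close to \<open>t\<close> lie
        at or below \<open>t\<close>. An earlier base point \<open>a\<close> in \<open>T\<close>
        makes \<open>F\<close> an indefinite integral there; without one, only \<open>s = t\<close>
        remains.\<close>
      have "\<exists>d>0. \<forall>s\<in>T. s \<le> t \<longrightarrow> t - s < d \<longrightarrow> dist (F s) (F t) < e"
      proof (cases "\<exists>a\<in>T. a < t")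
        case True
        then obtain a where a: "a \<in> T" "a < t"
          by blast
        have cont: "continuous_on {a..t} (\<lambda>x. integral {a..x} h)"
          by (intro indefinite_integral_continuous_1 int a)
        have "t \<in> {a..t}"
          using a(2) by simp
        then obtain d where d: "d > 0"
          "\<And>s. s \<in> {a..t} \<Longrightarrow> dist s t < d \<Longrightarrow> dist (integral {a..s} h) (integral {a..t} h) < e"
          using cont[unfolded continuous_on_iff, rule_format, of t e] \<open>e > 0\<close> by blast
        have "dist (F s) (F t) < e" if s: "s \<in> T" "s \<le> t" "t - s < min d (t - a)" for s
        proof -
          have "F s = F a + integral {a..s} h" "F t = F a + integral {a..t} h"
            using F_diff[OF a(1) s(1)] F_diff[OF a(1) t] s(3) a(2) by (simp_all add: diff_eq_eq add.commute)
          then show ?thesis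
            using d(2)[of s] s a(2) by (simp add: dist_real_def)
        qed
        then show ?thesis
          using d(1) a(2) by (intro exI[of _ "min d (t - a)"]) auto
      next
        case False
        then show ?thesis
          using \<open>e > 0\<close> by (intro exI[of _ 1]) (auto dest: antisym simp: not_less)
      qed
      then obtain d where d: "d > 0" "\<And>s. s \<in> T \<Longrightarrow> s \<le> t \<Longrightarrow> t - s < d \<Longrightarrow> dist (F s) (F t) < e"
        by blast
      have "dist (F s) (F t) < e" if "s \<in> T" "\<bar>s - t\<bar> < min d (\<sigma> - t)" for s
        using that gap[of s] by (intro d(2)) auto
      then show "eventually (\<lambda>s. dist (F s) (F t) < e) (delta_at T t)"
        unfolding eventually_delta_at using \<sigma>(2) d(1)
        by (intro exI[of _ "min d (\<sigma> - t)"]) auto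
    qed
    then show ?thesis
      using has_delta_derivative_scattered[OF t False] jump by (simp add: \<sigma>_def)
  qed
  then show ?thesis
    by (auto simp: delta_antiderivative_def kappa_def)
qed

section \<open>Regularity of the Cayley integrand\<close>

text \<open>Filling the removable singularity of \<open>f w / w\<close> allows composition with
  arguments that may vanish along the filter. It is used for a logarithm and for
  \<open>exp w - 1\<close>.\<close>

lemma has_field_derivative_0_imp_isCont:
  fixes f :: "complex \<Rightarrow> complex"
  assumes "(f has_field_derivative D) (at 0)" "f 0 = 0"
  shows "isCont (\<lambda>w. if w = 0 then D else f w / w) 0"
proof -
  have "((\<lambda>w. f w / w) \<longlongrightarrow> D) (at 0)"
    using assms by (simp add: has_field_derivative_iff)
  then have "((\<lambda>w. if w = 0 then D else f w / w) \<longlongrightarrow> D) (at 0)"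
    by (rule Lim_transform_eventually) (simp add: eventually_at_filter)
  then show ?thesis
    by (simp add: isCont_def)
qed

text \<open>With \<open>\<phi>\<close> continuous at \<open>0\<close> and
  \<open>\<phi> 0 = 2\<close>, the formula \<open>\<zeta>_h(z) = z/2 \<phi>(zh/2)\<close> covers
  \<open>h = 0\<close> and \<open>h \<noteq> 0\<close> at once.\<close>

lemma tendsto_cayley_zeta:
  assumes h: "(h \<longlongrightarrow> 0) F" and a: "(a \<longlongrightarrow> L) F"
  shows "((\<lambda>x. cayley_zeta (h x) (a x)) \<longlongrightarrow> L) F"
proof -
  define \<phi> :: "complex \<Rightarrow> complex"
    where "\<phi> = (\<lambda>w. if w = 0 then 2 else Ln ((1 + w) / (1 - w)) / w)"
  have "((\<lambda>w. Ln ((1 + w) / (1 - w))) has_field_derivative 2) (at 0)"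
    by (auto intro!: derivative_eq_intros)
  then have "isCont \<phi> 0"
    unfolding \<phi>_def by (rule has_field_derivative_0_imp_isCont) simp
  moreover have "((\<lambda>x. 1 / 2 * a x * complex_of_real (h x)) \<longlongrightarrow> 1 / 2 * L * complex_of_real 0) F"
    by (intro tendsto_intros h a)
  ultimately have "((\<lambda>x. \<phi> (1 / 2 * a x * complex_of_real (h x))) \<longlongrightarrow> \<phi> 0) F"
    by (intro isCont_tendsto_compose[of 0 \<phi>]) simp_all
  then have "((\<lambda>x. a x / 2 * \<phi> (1 / 2 * a x * complex_of_real (h x))) \<longlongrightarrow> L / 2 * \<phi> 0) F"
    by (intro tendsto_intros a) auto
  moreover have "z / 2 * \<phi> (1 / 2 * z * complex_of_real r) = cayley_zeta r z" for z r
    by (auto simp: \<phi>_def cayley_zeta_def)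
  ultimately show ?thesis
    by (simp add: \<phi>_def)
qed

text \<open>For \<open>s < t\<close> in \<open>T\<close> the jump cannot pass \<open>t\<close>, so
  \<open>\<mu>(s) \<le> t - s\<close>.\<close>

lemma tendsto_graininess_left:
  assumes "t \<in> T"
  shows "(graininess T \<longlongrightarrow> 0) (at t within (T \<inter> {..<t}))"
proof (rule tendstoI)
  fix e :: real assume "e > 0"
  have "dist (graininess T s) 0 < e" if "s \<in> T" "s < t" "dist s t < e" for s
    using fwd_jump_ge[OF that(1)] fwd_jump_le[OF assms that(2)] that
    by (simp add: graininess_def dist_real_def)
  then show "eventually (\<lambda>s. dist (graininess T s) 0 < e) (at t within (T \<inter> {..<t}))"
    using \<open>e > 0\<close> by (auto simp: eventually_at)
qed

text \<open>To the right of \<open>t\<close>, right-density gives a point \<open>u\<close> of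
  \<open>T\<close> within \<open>e\<close> of \<open>t\<close>, and no jump from a point between
  \<open>t\<close> and \<open>u\<close> can pass \<open>u\<close>.\<close>

lemma tendsto_graininess:
  assumes "t \<in> T" "right_dense T t"
  shows "(graininess T \<longlongrightarrow> 0) (at t within T)"
proof (rule tendstoI)
  fix e :: real assume "e > 0"
  have left: "dist (graininess T s) 0 < e" if "s \<in> T" "s < t" "t - s < e" for s
    using fwd_jump_ge[OF that(1)] fwd_jump_le[OF assms(1) that(2)] that
    by (simp add: graininess_def dist_real_def)
  have "\<exists>d>0. \<forall>s\<in>T. t < s \<longrightarrow> s - t < d \<longrightarrow> dist (graininess T s) 0 < e"
  proof (cases "\<exists>s\<in>T. t < s")
    case True
    then obtain u where u: "u \<in> T" "t < u" "u < t + e"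
      using right_dense_approx[OF assms(2), of _ "t + e"] \<open>e > 0\<close> by auto
    have "dist (graininess T s) 0 < e" if "s \<in> T" "t < s" "s - t < u - t" for s
      using fwd_jump_ge[OF that(1)] fwd_jump_le[OF u(1), of s] that u
      by (simp add: graininess_def dist_real_def)
    then show ?thesis
      using u by (intro exI[of _ "u - t"]) auto
  qed (auto intro: exI[of _ 1])
  then obtain d where "d > 0" "\<And>s. s \<in> T \<Longrightarrow> t < s \<Longrightarrow> s - t < d \<Longrightarrow> dist (graininess T s) 0 < e"
    by blast
  then show "eventually (\<lambda>s. dist (graininess T s) 0 < e) (at t within T)"
    unfolding eventually_at using left \<open>e > 0\<close>
    by (intro exI[of _ "min d e"]) (auto simp: dist_real_def neq_iff)
qed

text \<open>The limits in rd-continuity are all taken where the graininess tends to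
  \<open>0\<close>; there the argument of \<open>Ln\<close> tends to \<open>1\<close>, away from the
  branch cut.\<close>

lemma rd_continuous_cayley_zeta:
  assumes "rd_continuous T \<alpha>"
  shows "rd_continuous T (\<lambda>s. cayley_zeta (graininess T s) (\<alpha> s))"
  unfolding rd_continuous_def
proof (intro conjI ballI impI)
  fix t assume t: "t \<in> T" "right_dense T t"
  then have "(\<alpha> \<longlongrightarrow> \<alpha> t) (at t within T)"
    using assms by (simp add: rd_continuous_def continuous_within)
  from tendsto_cayley_zeta[OF tendsto_graininess[OF t] this]
  show "continuous (at t within T) (\<lambda>s. cayley_zeta (graininess T s) (\<alpha> s))"
    using t(2) by (simp add: continuous_within graininess_def right_dense_def cayley_zeta_def)
next
  fix t assume t: "t \<in> T" "left_dense T t"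
  then obtain l where "(\<alpha> \<longlongrightarrow> l) (at t within (T \<inter> {..<t}))"
    using assms by (auto simp: rd_continuous_def)
  from tendsto_cayley_zeta[OF tendsto_graininess_left[OF t(1)] this]
  show "\<exists>l. ((\<lambda>s. cayley_zeta (graininess T s) (\<alpha> s)) \<longlongrightarrow> l) (at t within (T \<inter> {..<t}))"
    by blast
qed

lemma rd_continuous_cmult:
  assumes "rd_continuous T f"
  shows "rd_continuous T (\<lambda>t. c * f t)"
  unfolding rd_continuous_def
proof (intro conjI ballI impI)
  fix t assume "t \<in> T" "left_dense T t"
  then obtain l where "(f \<longlongrightarrow> l) (at t within (T \<inter> {..<t}))"
    using assms by (auto simp: rd_continuous_def)
  then show "\<exists>l. ((\<lambda>t. c * f t) \<longlongrightarrow> l) (at t within (T \<inter> {..<t}))"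
    using tendsto_mult_left by blast
qed (use assms in \<open>auto simp: rd_continuous_def intro!: continuous_intros\<close>)

section \<open>The delta equation of the Cayley exponential\<close>

text \<open>The difference quotient of \<open>exp (F s)\<close> is that of \<open>F\<close> times
  \<open>exp (F t) \<psi>(F s - F t)\<close>, where \<open>\<psi>\<close> is continuous at
  \<open>0\<close> with value \<open>1\<close>.\<close>

lemma has_delta_derivative_exp_dense:
  assumes "t \<in> T" "fwd_jump T t = t" "has_delta_derivative T F D t"
  shows "has_delta_derivative T (\<lambda>s. exp (F s)) (D * exp (F t)) t"
proof -
  define \<psi> :: "complex \<Rightarrow> complex" where "\<psi> = (\<lambda>w. if w = 0 then 1 else (exp w - 1) / w)"
  have "((\<lambda>w::complex. exp w - 1) has_field_derivative 1) (at 0)"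
    by (auto intro!: derivative_eq_intros)
  then have "isCont \<psi> 0"
    unfolding \<psi>_def by (rule has_field_derivative_0_imp_isCont) simp
  moreover have "((\<lambda>s. F s - F t) \<longlongrightarrow> F t - F t) (delta_at T t)"
    by (intro tendsto_intros delta_derivative_imp_tendsto[OF assms(1,3)])
  ultimately have "((\<lambda>s. \<psi> (F s - F t)) \<longlongrightarrow> \<psi> 0) (delta_at T t)"
    by (intro isCont_tendsto_compose[of 0 \<psi>]) simp_all
  then have "((\<lambda>s. exp (F t) * \<psi> (F s - F t) * ((F t - F s) / complex_of_real (t - s))) \<longlongrightarrow>
      exp (F t) * \<psi> 0 * D) (delta_at T t)"
    using assms(3)[unfolded has_delta_derivative_iff assms(2)] by (intro tendsto_mult tendsto_const)
  moreover have "exp (F t) * \<psi> (F s - F t) * ((F t - F s) / c) = (exp (F t) - exp (F s)) / c" for s c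
  proof -
    have "\<psi> (F s - F t) * (F t - F s) = 1 - exp (F s - F t)"
      by (auto simp: \<psi>_def divide_simps) (simp add: algebra_simps)
    then have "exp (F t) * (\<psi> (F s - F t) * (F t - F s)) = exp (F t) - exp (F s)"
      by (simp add: exp_diff right_diff_distrib)
    then show ?thesis
      by (simp add: mult.assoc)
  qed
  moreover have "exp (F t) * \<psi> 0 * D = D * exp (F t)"
    by (simp add: \<psi>_def)
  ultimately show ?thesis
    unfolding has_delta_derivative_iff assms(2) by (simp only:)
qed

text \<open>The integral from \<open>0\<close> to \<open>0\<close> is a definite description too,
  and it is known to be \<open>0\<close> only once an antiderivative exists.\<close>

lemma cayley_exp_zero:
  assumes "closed T" "0 \<in> T" "rd_continuous T \<alpha>"
  shows "cayley_exp T \<alpha> 0 = 1"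
proof -
  obtain F where "delta_antiderivative T (\<lambda>s. cayley_zeta (graininess T s) (\<alpha> s)) F"
    using rd_continuous_imp_antiderivative[OF assms(1) _ rd_continuous_cayley_zeta[OF assms(3)]]
      assms(2) by blast
  from delta_integral_eq[OF assms(1,2,2) this] show ?thesis
    by (simp add: cayley_exp_def)
qed

lemma has_delta_derivative_cayley_exp:
  assumes T: "closed T" "0 \<in> T" and rd: "rd_continuous T \<alpha>" and reg: "regressive T \<alpha>"
    and t: "t \<in> kappa T"
  shows "has_delta_derivative T (cayley_exp T \<alpha>) (\<alpha> t * jump_avg T (cayley_exp T \<alpha>) t) t"
proof -
  let ?\<sigma> = "fwd_jump T t" and ?Z = "\<lambda>s. cayley_zeta (graininess T s) (\<alpha> s)"
  obtain F where F: "delta_antiderivative T ?Z F"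
    using rd_continuous_imp_antiderivative[OF T(1) _ rd_continuous_cayley_zeta[OF rd]] T(2) by blast
  define G where "G = (\<lambda>s. exp (F s - F 0))"
  have G: "G s = cayley_exp T \<alpha> s" if "s \<in> T" for s
    using delta_integral_eq[OF T that F] by (simp add: G_def cayley_exp_def)
  have tT: "t \<in> T" and \<sigma>T: "?\<sigma> \<in> T"
    using t fwd_jump_mem[OF T(1)] by (auto simp: kappa_def)
  have dF: "has_delta_derivative T F (?Z t) t"
    using F t by (simp add: delta_antiderivative_def)
  have "has_delta_derivative T G (\<alpha> t * jump_avg T G t) t"
  proof (cases "?\<sigma> = t")
    case True
    have "has_delta_derivative T (\<lambda>s. F s - F 0) (?Z t) t"
      using dF by (simp add: has_delta_derivative_iff)
    from has_delta_derivative_exp_dense[OF tT True this] show ?thesis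
      using True by (simp add: G_def jump_avg_def graininess_def cayley_zeta_def)
  next
    case False
    define z where "z = 1 / 2 * \<alpha> t * complex_of_real (graininess T t)"
    \<comment> \<open>The two halves of regressivity: \<open>z \<noteq> 1\<close> keeps the
      denominator of the Cayley transform nonzero, \<open>z \<noteq> -1\<close> keeps the argument
      of \<open>Ln\<close> nonzero, so that \<open>exp\<close> undoes \<open>Ln\<close>.\<close>
    have "z \<noteq> 1" "z \<noteq> -1"
      using reg t by (auto simp: regressive_def z_def mult.commute)
    then have nz: "1 - z \<noteq> 0" "1 + z \<noteq> 0"
      by (auto simp: add_eq_0_iff)
    have "F ?\<sigma> - F t = complex_of_real (graininess T t) * ?Z t"
      by (rule delta_derivative_scattered[OF tT False dF])
    also have "\<dots> = Ln ((1 + z) / (1 - z))"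
      using False by (simp add: cayley_zeta_def graininess_def z_def)
    finally have "exp (F ?\<sigma> - F t) = (1 + z) / (1 - z)"
      using nz by simp
    moreover have "G ?\<sigma> = G t * exp (F ?\<sigma> - F t)"
      by (simp add: G_def flip: exp_add)
    ultimately have "G ?\<sigma> = G t * ((1 + z) / (1 - z))"
      by (simp only:)
    then have "G ?\<sigma> * (1 - z) = G t * (1 + z)"
      using nz by simp
    then have "G ?\<sigma> - G t = z * (G t + G ?\<sigma>)"
      by (simp add: algebra_simps)
    also have "\<dots> = complex_of_real (graininess T t) * (\<alpha> t * jump_avg T G t)"
      by (simp add: z_def jump_avg_def)
    finally have jump: "G ?\<sigma> - G t = complex_of_real (graininess T t) * (\<alpha> t * jump_avg T G t)" .
    have "(G \<longlongrightarrow> G t) (delta_at T t)"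
      unfolding G_def by (intro tendsto_intros delta_derivative_imp_tendsto[OF tT dF])
    from has_delta_derivative_scattered[OF tT False this jump] show ?thesis .
  qed
  then show ?thesis
    using has_delta_derivative_cong[OF T(1) tT G] by (simp add: jump_avg_def G tT \<sigma>T)
qed

section \<open>Conserved products and the Cayley-trigonometric functions\<close>

text \<open>The two terms of the symmetric Leibniz rule are
  \<open>\<alpha> \<langle>X\<rangle> \<langle>Y\<rangle>\<close> and its negative.\<close>

lemma cayley_mult_const:
  assumes "closed T" "a \<in> T" "b \<in> T"
    and "\<And>t. t \<in> kappa T \<Longrightarrow> has_delta_derivative T X (\<alpha> t * jump_avg T X t) t"
    and "\<And>t. t \<in> kappa T \<Longrightarrow> has_delta_derivative T Y (- \<alpha> t * jump_avg T Y t) t"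
  shows "X a * Y a = X b * Y b"
proof (rule delta_derivative_zero_imp_const[OF assms(1-3)])
  fix t assume t: "t \<in> kappa T"
  then have "t \<in> T"
    by (simp add: kappa_def)
  from has_delta_derivative_mult[OF this assms(4,5)[OF t]]
  show "has_delta_derivative T (\<lambda>s. X s * Y s) 0 t"
    by (simp add: algebra_simps)
qed

theorem theorem3p20:
  fixes T :: "real set" and \<omega> :: "real \<Rightarrow> complex"
  assumes "time_scale T" and "0 \<in> T"
    and "rd_continuous T \<omega>"
    and "regressive T (\<lambda>t. \<i> * \<omega> t)"
  shows "((\<forall>t\<in>T. \<omega> t \<in> \<real>) \<longrightarrow> (\<forall>t\<in>T. cayley_cos T \<omega> t \<in> \<real> \<and> cayley_sin T \<omega> t \<in> \<real>)) \<and>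
    (\<forall>t\<in>T. (cayley_cos T \<omega> t)\<^sup>2 + (cayley_sin T \<omega> t)\<^sup>2 = 1) \<and>
    (\<forall>t\<in>kappa T.
       has_delta_derivative T (cayley_cos T \<omega>) (- \<omega> t * jump_avg T (cayley_sin T \<omega>) t) t \<and>
       has_delta_derivative T (cayley_sin T \<omega>) (\<omega> t * jump_avg T (cayley_cos T \<omega>) t) t)"
proof -
  define P where "P = cayley_exp T (\<lambda>s. \<i> * \<omega> s)"
  define N where "N = cayley_exp T (\<lambda>s. - \<i> * \<omega> s)"
  have closed: "closed T"
    using assms(1) by (simp add: time_scale_def)
  have rd: "rd_continuous T (\<lambda>s. \<i> * \<omega> s)" "rd_continuous T (\<lambda>s. - \<i> * \<omega> s)"
    using rd_continuous_cmult[OF assms(3), of "\<i>"] rd_continuous_cmult[OF assms(3), of "- \<i>"]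
    by simp_all
  \<comment> \<open>Negation swaps the two excluded values, so regressivity passes to
    \<open>- \<i> * \<omega>\<close>.\<close>
  have "- x \<noteq> 2 \<and> - x \<noteq> - 2" if "x \<noteq> 2 \<and> x \<noteq> - 2" for x :: complex
    using that by (metis minus_minus)
  then have reg: "regressive T (\<lambda>s. - \<i> * \<omega> s)"
    using assms(4) by (simp add: regressive_def)
  have dP: "has_delta_derivative T P (\<i> * \<omega> t * jump_avg T P t) t" if "t \<in> kappa T" for t
    unfolding P_def by (rule has_delta_derivative_cayley_exp[OF closed assms(2) rd(1) assms(4) that])
  have dN: "has_delta_derivative T N (- \<i> * \<omega> t * jump_avg T N t) t" if "t \<in> kappa T" for t
    unfolding N_def by (rule has_delta_derivative_cayley_exp[OF closed assms(2) rd(2) reg that])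
  have zero: "P 0 = 1" "N 0 = 1"
    unfolding P_def N_def by (rule cayley_exp_zero[OF closed assms(2)], rule rd)+
  \<comment> \<open>Written as linear combinations, using
    \<open>1 / (2 * \<i>) = - \<i> / 2\<close>, to fit
    \<open>has_delta_derivative_linear\<close>.\<close>
  have cos: "cayley_cos T \<omega> = (\<lambda>s. 1 / 2 * P s + 1 / 2 * N s)"
    and sin: "cayley_sin T \<omega> = (\<lambda>s. - \<i> / 2 * P s + \<i> / 2 * N s)"
    by (auto simp: fun_eq_iff cayley_cos_def cayley_sin_def P_def N_def field_simps)
  have PN: "P t * N t = 1" if "t \<in> T" for t
    using cayley_mult_const[OF closed that assms(2), of P "\<lambda>s. \<i> * \<omega> s" N] dP dN zero by simp

  have "cayley_cos T \<omega> t \<in> \<real> \<and> cayley_sin T \<omega> t \<in> \<real>"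
    if real: "\<forall>t\<in>T. \<omega> t \<in> \<real>" and t: "t \<in> T" for t
  proof -
    have "has_delta_derivative T (\<lambda>s. cnj (P s)) (- (\<i> * \<omega> s) * jump_avg T (\<lambda>s. cnj (P s)) s) s"
      if "s \<in> kappa T" for s
    proof -
      have "cnj (\<omega> s) = \<omega> s"
        using real that by (simp add: kappa_def Reals_cnj_iff)
      then show ?thesis
        using has_delta_derivative_cnj[OF dP[OF that]] by (simp add: jump_avg_def)
    qed
    then have "P t * cnj (P t) = 1"
      using cayley_mult_const[OF closed t assms(2), of P "\<lambda>s. \<i> * \<omega> s" "\<lambda>s. cnj (P s)"] dP zero
      by simp
    \<comment> \<open>Both \<open>cnj (P t)\<close> and \<open>N t\<close> are inverses of
      \<open>P t\<close>, hence equal.\<close>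
    then have "P t * cnj (P t) = P t * N t" "P t \<noteq> 0"
      using PN[OF t] by auto
    then have N: "N t = cnj (P t)"
      by simp
    show ?thesis
      by (simp add: cos sin N complex_is_Real_iff)
  qed
  moreover have "(cayley_cos T \<omega> t)\<^sup>2 + (cayley_sin T \<omega> t)\<^sup>2 = 1" if "t \<in> T" for t
  proof -
    \<comment> \<open>The squares are \<open>(P + N)^2 / 4\<close> and
      \<open>-(P - N)^2 / 4\<close>, so only the mixed terms survive.\<close>
    have "(cayley_cos T \<omega> t)\<^sup>2 + (cayley_sin T \<omega> t)\<^sup>2 = P t * N t"
      by (simp add: cos sin power2_eq_square field_simps)
    then show ?thesis
      using PN[OF that] by simp
  qed
  moreover have "has_delta_derivative T (cayley_cos T \<omega>) (- \<omega> t * jump_avg T (cayley_sin T \<omega>) t) t"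
    if "t \<in> kappa T" for t
  proof -
    have "1 / 2 * (\<i> * \<omega> t * jump_avg T P t) + 1 / 2 * (- \<i> * \<omega> t * jump_avg T N t) =
        - \<omega> t * jump_avg T (cayley_sin T \<omega>) t"
      by (simp add: sin jump_avg_def field_simps)
    then show ?thesis
      using has_delta_derivative_linear[OF dP[OF that] dN[OF that], of "1 / 2" "1 / 2"]
      unfolding cos by simp
  qed
  moreover have "has_delta_derivative T (cayley_sin T \<omega>) (\<omega> t * jump_avg T (cayley_cos T \<omega>) t) t"
    if "t \<in> kappa T" for t
  proof -
    have "- \<i> / 2 * (\<i> * \<omega> t * jump_avg T P t) + \<i> / 2 * (- \<i> * \<omega> t * jump_avg T N t) =
        \<omega> t * jump_avg T (cayley_cos T \<omega>) t"
      by (simp add: cos jump_avg_def field_simps)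
    then show ?thesis
      using has_delta_derivative_linear[OF dP[OF that] dN[OF that], of "- \<i> / 2" "\<i> / 2"]
      unfolding sin by simp
  qed
  ultimately show ?thesis
    by blast
qed

end
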